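(* Let $(T(t))_{t\ge 0}$ be a quasi-multiplication semigroup on a Banach space $X$ with generator $-A$. Assume that $$0\in\sigma(A)\subset\mathbb{C}_+\cup\{0\}\qquad\text{and}\qquad\|(is+A)^{-1}\|=O(1),\quad |s|\to\infty.$$ Let $c>0$, let $$m(s)=\sup\{\|(ir+A)^{-1}\| : |r|\ge s\},\qquad s>0,$$ and let $m^{-1}$ be any right inverse for $m$. Then the following are equivalent: (i) There exists $C$ such that $$\|T(t)A(I+A)^{-1}\|\le C\,m^{-1}(ct),\qquad t\ge c^{-1}m(1);$$ (ii) There exists $B$ such that $$\frac{m(\tau)}{m(s)}\ge c\log\left(\frac{s}{\tau}\right)-B,\qquad 0<\tau,s\le 1.$$
   Context: $\mathbb{C}_+=\{\lambda\in\mathbb{C}:\operatorname{Re}\lambda>0\}$. A quasi-multiplication semigroup is a bounded $C_0$-semigroup $(T(t))_{t\ge0}$ with generator $-A$ such that $$\|T(t)r(A)\|=\sup\big\{|e^{-\lambda t}r(\lambda)| : \lambda\in\sigma(A)\big\}$$ for every $t\ge 0$ and every rational function $r$ whose poles are outside $\sigma(A)$ and which is bounded at infinity. The function $m$ is continuous and decreasing (not necessarily strictly), with $m(s)\ge 1/s$; a right inverse $m^{-1}$ satisfies $m(m^{-1}(t))=t$ on the range of $m$. *)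

theory Defs
  imports
    "HOL-Analysis.Analysis"
    "HOL-Library.Landau_Symbols"
    "HOL-Computational_Algebra.Polynomial"
begin

class complex_normed_vector = real_normed_vector +
  fixes scaleC :: "complex \<Rightarrow> 'a \<Rightarrow> 'a"  (infixr "*\<^sub>C" 75)
  assumes scaleC_add_right: "a *\<^sub>C (x + y) = a *\<^sub>C x + a *\<^sub>C y"
    and scaleC_add_left: "(a + b) *\<^sub>C x = a *\<^sub>C x + b *\<^sub>C x"
    and scaleC_scaleC: "a *\<^sub>C b *\<^sub>C x = (a * b) *\<^sub>C x"
    and scaleC_of_real: "complex_of_real r *\<^sub>C x = r *\<^sub>R x"
    and norm_scaleC: "norm (a *\<^sub>C x) = cmod a * norm x"

class complex_banach = complex_normed_vector + banach

definition bounded_clinear ::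
    "('a::complex_normed_vector \<Rightarrow> 'b::complex_normed_vector) \<Rightarrow> bool" where
  "bounded_clinear f \<longleftrightarrow> bounded_linear f \<and> (\<forall>a x. f (a *\<^sub>C x) = a *\<^sub>C f x)"


text \<open>An unbounded operator is given by its domain \<open>D\<close> together with a total function \<open>A\<close>,
  whose values outside \<open>D\<close> play no role.\<close>

definition resolvent_set ::
    "'a::complex_banach set \<Rightarrow> ('a \<Rightarrow> 'a) \<Rightarrow> complex set" where
  "resolvent_set D A =
    {z. bij_betw (\<lambda>x. z *\<^sub>C x - A x) D UNIV \<and>
        bounded_clinear (inv_into D (\<lambda>x. z *\<^sub>C x - A x))}"

definition spectrum :: "'a::complex_banach set \<Rightarrow> ('a \<Rightarrow> 'a) \<Rightarrow> complex set" where
  "spectrum D A = - resolvent_set D A"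

text \<open>The operator \<open>(z + A)\<^sup>-\<^sup>1\<close>; meaningful if \<open>- z\<close> lies in the resolvent set of \<open>A\<close>.\<close>

definition plus_inv :: "'a::complex_banach set \<Rightarrow> ('a \<Rightarrow> 'a) \<Rightarrow> complex \<Rightarrow> 'a \<Rightarrow> 'a" where
  "plus_inv D A z = inv_into D (\<lambda>x. z *\<^sub>C x + A x)"

definition pow_domain :: "'a set \<Rightarrow> ('a \<Rightarrow> 'a) \<Rightarrow> nat \<Rightarrow> 'a set" where
  "pow_domain D A n = {x. \<forall>i<n. (A ^^ i) x \<in> D}"

definition poly_op :: "('a::complex_banach \<Rightarrow> 'a) \<Rightarrow> complex poly \<Rightarrow> 'a \<Rightarrow> 'a" where
  "poly_op A p x = (\<Sum>i\<le>degree p. coeff p i *\<^sub>C (A ^^ i) x)"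

text \<open>For \<open>r = p / q\<close> with \<open>degree p \<le> degree q\<close> and no zero of \<open>q\<close> in the spectrum of \<open>A\<close>,
  the operator \<open>q(A)\<close> maps its domain \<open>D(A\<^sup>n)\<close>, \<open>n = degree q\<close>, bijectively onto the whole space, and
  \<open>r(A) = p(A) q(A)\<^sup>-\<^sup>1\<close> is everywhere defined and bounded.\<close>

definition rat_op ::
    "'a::complex_banach set \<Rightarrow> ('a \<Rightarrow> 'a) \<Rightarrow> complex poly \<Rightarrow> complex poly \<Rightarrow> 'a \<Rightarrow> 'a" where
  "rat_op D A p q x = poly_op A p (inv_into (pow_domain D A (degree q)) (poly_op A q) x)"


definition C0_semigroup :: "(real \<Rightarrow> 'a::complex_banach \<Rightarrow> 'a) \<Rightarrow> bool" where
  "C0_semigroup T \<longleftrightarrow>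
    (\<forall>t\<ge>0. bounded_clinear (T t)) \<and>
    (\<forall>x. T 0 x = x) \<and>
    (\<forall>s\<ge>0. \<forall>t\<ge>0. \<forall>x. T (s + t) x = T s (T t x)) \<and>
    (\<forall>x. ((\<lambda>t. T t x) \<longlongrightarrow> x) (at_right 0))"

definition is_generator ::
    "(real \<Rightarrow> 'a::complex_banach \<Rightarrow> 'a) \<Rightarrow> 'a set \<Rightarrow> ('a \<Rightarrow> 'a) \<Rightarrow> bool" where
  "is_generator T D G \<longleftrightarrow>
    D = {x. \<exists>y. ((\<lambda>h. (T h x - x) /\<^sub>R h) \<longlongrightarrow> y) (at_right 0)} \<and>
    (\<forall>x\<in>D. ((\<lambda>h. (T h x - x) /\<^sub>R h) \<longlongrightarrow> G x) (at_right 0))"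

text \<open>Here \<open>- A\<close> is the generator. A rational function is written as \<open>p / q\<close> in lowest terms, so
  its poles are the zeros of \<open>q\<close>, and it is bounded at infinity iff \<open>degree p \<le> degree q\<close>.
  The supremum is taken in \<open>[0, \<infinity>]\<close>.\<close>

definition quasi_multiplication_semigroup ::
    "(real \<Rightarrow> 'a::complex_banach \<Rightarrow> 'a) \<Rightarrow> 'a set \<Rightarrow> ('a \<Rightarrow> 'a) \<Rightarrow> bool" where
  "quasi_multiplication_semigroup T D A \<longleftrightarrow>
    C0_semigroup T \<and>
    (\<exists>M. \<forall>t\<ge>0. onorm (T t) \<le> M) \<and>
    is_generator T D (\<lambda>x. - A x) \<and>
    (\<forall>t\<ge>0. \<forall>p q. q \<noteq> 0 \<and> coprime p q \<and> degree p \<le> degree q \<and>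
        (\<forall>z\<in>spectrum D A. poly q z \<noteq> 0) \<longrightarrow>
      ennreal (onorm (\<lambda>x. T t (rat_op D A p q x))) =
      (SUP z\<in>spectrum D A. ennreal (cmod (exp (- z * of_real t) * (poly p z / poly q z)))))"

end

theory Submission imports Defs begin

text \<open>
  Write \<open>\<sigma>\<close> for the spectrum of \<open>A\<close>. The norm formula of a quasi-multiplication semigroup turns both
  conditions into statements about the planar set \<open>\<sigma>\<close>. Applied to \<open>1 / (\<lambda> + \<i> r)\<close> at time \<open>0\<close> it says
  that \<open>\<parallel>(\<i> r + A)\<^sup>-\<^sup>1\<parallel>\<close> is the inverse of the distance from \<open>- \<i> r\<close> to \<open>\<sigma>\<close>, so that
  \<open>m s = 1 / gap \<sigma> s\<close>, where \<open>gap \<sigma> s\<close> is the distance from \<open>\<sigma>\<close> to the part \<open>\<bar>Im z\<bar> \<ge> s\<close> of the imaginary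
  axis. Applied to \<open>\<lambda> / (1 + \<lambda>)\<close> it says that \<open>\<parallel>T(t) A (I + A)\<^sup>-\<^sup>1\<parallel>\<close> is the supremum over \<open>\<sigma>\<close> of
  \<open>exp (- t Re \<lambda>) \<bar>\<lambda>\<bar> / \<bar>1 + \<lambda>\<bar>\<close>. At the time \<open>t = m \<tau> / c = 1 / (c gap \<sigma> \<tau>)\<close> the claimed equivalence
  says that the bound \<open>exp (- Re \<lambda> / (c gap \<sigma> \<tau>)) \<bar>\<lambda>\<bar> / \<bar>1 + \<lambda>\<bar> \<le> C \<tau>\<close> for all \<open>\<lambda> \<in> \<sigma>\<close> and \<open>\<tau> \<le> 1\<close> amounts
  to \<open>gap \<sigma> s / gap \<sigma> \<tau> \<ge> c ln (s / \<tau>) - B\<close> for all \<open>\<tau>, s \<le> 1\<close>.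

  The gap condition implies the bound (\<open>damped_multiplier_le\<close>): a point \<open>\<lambda>\<close> of \<open>\<sigma>\<close> at height \<open>s = \<bar>Im \<lambda>\<bar>\<close> satisfies
  \<open>Re \<lambda> \<ge> gap \<sigma> s\<close>, so the exponential is at most a multiple of \<open>\<tau> / s\<close>, which compensates \<open>\<bar>\<lambda>\<bar>\<close> as long as
  \<open>\<bar>\<lambda>\<bar>\<close> is comparable with \<open>s\<close>. The other points lie in the sector \<open>\<bar>Im \<lambda>\<bar> \<le> Re \<lambda>\<close>, where \<open>x exp (- x) \<le> 1\<close> suffices.

  The bound implies the gap condition (\<open>gap_ratio_ge\<close>): if \<open>gap \<sigma> s\<close> is comparable with \<open>s\<close>, then the ratio of the gaps is at least a
  multiple of \<open>s / \<tau>\<close>, which dominates the logarithm. Otherwise a point \<open>\<lambda>\<close> of \<open>\<sigma>\<close> that almost realises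
  \<open>gap \<sigma> s\<close> has \<open>\<bar>\<lambda>\<bar> \<ge> s / 2\<close> and \<open>Re \<lambda> \<le> gap \<sigma> s + gap \<sigma> \<tau>\<close>, and taking logarithms in the bound at
  this point gives the claim.

  The function \<open>m\<close> may be constant on intervals, and a right inverse may pick any point of such an
  interval. This does no harm: at times slightly later than \<open>m \<tau> / c\<close> every right inverse has a value below \<open>\<tau>\<close>,
  and for a single \<open>\<lambda>\<close> a small delay changes the exponential by a bounded factor only.
\<close>

section \<open>Distance from a planar set to the ends of the imaginary axis\<close>

definition gap :: "complex set \<Rightarrow> real \<Rightarrow> real" where
  "gap S s = setdist S {z. Re z = 0 \<and> s \<le> \<bar>Im z\<bar>}"

lemma gap_le_dist:
  assumes "z \<in> S" "s \<le> \<bar>r\<bar>"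
  shows "gap S s \<le> cmod (z + \<i> * of_real r)"
proof -
  have "gap S s \<le> dist z (- (\<i> * of_real r))"
    unfolding gap_def using assms by (intro setdist_le_dist) auto
  then show ?thesis by (simp add: dist_norm)
qed

lemma gap_geI:
  assumes "S \<noteq> {}" and bound: "\<And>z r. z \<in> S \<Longrightarrow> s \<le> \<bar>r\<bar> \<Longrightarrow> d \<le> cmod (z + \<i> * of_real r)"
  shows "d \<le> gap S s"
  unfolding gap_def
proof (rule le_setdistI)
  have "\<i> * of_real \<bar>s\<bar> \<in> {z. Re z = 0 \<and> s \<le> \<bar>Im z\<bar>}" by simp
  then show "{z. Re z = 0 \<and> s \<le> \<bar>Im z\<bar>} \<noteq> {}" by blast
  show "d \<le> dist z w" if "z \<in> S" "w \<in> {z. Re z = 0 \<and> s \<le> \<bar>Im z\<bar>}" for z w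
  proof -
    have "w = \<i> * of_real (Im w)" using that(2) by (simp add: complex_eq_iff)
    then have "dist z w = cmod (z + \<i> * of_real (- Im w))"
      by (simp add: dist_norm)
    then show ?thesis using bound[of z "- Im w"] that by simp
  qed
qed fact

lemma gap_almost_attained:
  assumes "S \<noteq> {}" "gap S s < d"
  obtains z r where "z \<in> S" "s \<le> \<bar>r\<bar>" "cmod (z + \<i> * of_real r) < d"
  using gap_geI[OF assms(1), of s d] assms(2) by force

lemma gap_le_Re: "z \<in> S \<Longrightarrow> 0 \<le> Re z \<Longrightarrow> s \<le> \<bar>Im z\<bar> \<Longrightarrow> gap S s \<le> Re z"
  using gap_le_dist[of z S s "- Im z"] by (simp add: cmod_def)

lemma gap_le_self: "0 \<in> S \<Longrightarrow> 0 \<le> s \<Longrightarrow> gap S s \<le> s"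
  using gap_le_dist[of 0 S s s] by (simp add: norm_mult)

lemma gap_mono:
  assumes "S \<noteq> {}" "s \<le> s'"
  shows "gap S s \<le> gap S s'"
  using assms by (intro gap_geI gap_le_dist) auto

text \<open>A point of the axis at height at least \<open>s\<close> is moved to height at least \<open>s'\<close> by shifting it
  by \<open>s' - s\<close> away from the origin.\<close>

lemma gap_increment_le:
  assumes "S \<noteq> {}" "0 < s" "s \<le> s'"
  shows "gap S s' \<le> gap S s + (s' - s)"
proof -
  have "gap S s' - (s' - s) \<le> gap S s"
  proof (rule gap_geI[OF assms(1)])
    fix z and r :: real assume z: "z \<in> S" and r: "s \<le> \<bar>r\<bar>"
    define h where "h = sgn r * (s' - s)"
    have "\<bar>r + h\<bar> \<ge> s'" "\<bar>h\<bar> = s' - s"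
      using r assms unfolding h_def by (auto simp: sgn_if abs_if split: if_splits)
    then have "gap S s' \<le> cmod (z + \<i> * of_real (r + h))"
      using gap_le_dist[OF z] by blast
    also have "\<dots> = cmod ((z + \<i> * of_real r) + \<i> * of_real h)"
      by (simp add: algebra_simps)
    also have "\<dots> \<le> cmod (z + \<i> * of_real r) + (s' - s)"
      using norm_triangle_ineq[of "z + \<i> * of_real r" "\<i> * of_real h"] \<open>\<bar>h\<bar> = s' - s\<close>
      by (simp add: norm_mult)
    finally show "gap S s' - (s' - s) \<le> cmod (z + \<i> * of_real r)" by simp
  qed
  then show ?thesis by simp
qed

lemma continuous_on_gap:
  assumes "S \<noteq> {}"
  shows "continuous_on {0<..} (gap S)"
proof (rule continuous_onI)
  fix x e :: real assume x: "x \<in> {0<..}" and e: "e > 0"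
  have "dist (gap S y) (gap S x) \<le> e" if "y \<in> {0<..}" "dist y x < e" for y
    using gap_increment_le[OF assms, of x y] gap_increment_le[OF assms, of y x]
      gap_mono[OF assms, of x y] gap_mono[OF assms, of y x] x that
    by (cases "x \<le> y") (auto simp: dist_real_def)
  then show "\<exists>d>0. \<forall>y\<in>{0<..}. dist y x < d \<longrightarrow> dist (gap S y) (gap S x) \<le> e"
    using e by blast
qed

lemma gap_surj:
  assumes "0 \<in> S" "0 < v" "v \<le> gap S 1"
  shows "\<exists>\<tau>>0. gap S \<tau> = v"
proof -
  have "v \<le> 1" "gap S v \<le> v" using assms gap_le_self[of S 1] gap_le_self[of S v] by auto
  moreover have "continuous_on {v..1} (gap S)"
    using assms by (intro continuous_on_subset[OF continuous_on_gap]) auto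
  ultimately obtain \<tau> where "v \<le> \<tau>" "gap S \<tau> = v"
    using IVT'[of "gap S" v v 1] assms by auto
  then show ?thesis using assms by (intro exI[of _ \<tau>]) auto
qed

section \<open>The gap condition and the damped multiplier\<close>

locale spectral_region =
  fixes S :: "complex set" and c :: real
  assumes zero_mem: "0 \<in> S"
    and Re_nonneg: "z \<in> S \<Longrightarrow> 0 \<le> Re z"
    and gap_pos: "0 < s \<Longrightarrow> 0 < gap S s"
    and c_pos: "0 < c"
begin

text \<open>In the sector \<open>\<bar>Im z\<bar> \<le> Re z\<close> the exponential alone absorbs \<open>\<bar>z\<bar> \<le> 2 Re z\<close>. Outside it the hypothesis
  is used at \<open>s = min 1 \<bar>Im z\<bar>\<close>, and \<open>\<bar>z\<bar> / \<bar>1 + z\<bar> \<le> 2 s\<close>: the hypothesis reaches only up to height \<open>1\<close>, which is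
  enough because the multiplier is at most \<open>1\<close>.\<close>

lemma damped_multiplier_le:
  assumes ratio: "\<And>\<tau> s. 0 < \<tau> \<Longrightarrow> \<tau> \<le> 1 \<Longrightarrow> 0 < s \<Longrightarrow> s \<le> 1 \<Longrightarrow>
      c * ln (s / \<tau>) - B \<le> gap S s / gap S \<tau>"
    and z: "z \<in> S" and \<tau>: "0 < \<tau>" "\<tau> \<le> 1"
  shows "exp (- Re z / (c * gap S \<tau>)) * (cmod z / cmod (1 + z)) \<le> (2 * c + 2 * exp (B / c)) * \<tau>"
proof -
  have x: "0 \<le> Re z" using Re_nonneg z .
  have g: "0 < gap S \<tau>" "gap S \<tau> \<le> \<tau>" using gap_pos gap_le_self zero_mem \<tau> by auto
  have one_plus: "1 \<le> cmod (1 + z)" "cmod z \<le> cmod (1 + z)"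
    using complex_Re_le_cmod[of "1 + z"] x
    by (auto simp: cmod_def power2_eq_square algebra_simps intro!: real_sqrt_le_mono)
  then have mult: "cmod z / cmod (1 + z) \<le> cmod z" "cmod z / cmod (1 + z) \<le> 1"
    by (auto simp: divide_le_eq mult_le_cancel_left1)
  have cz: "cmod z \<le> Re z + \<bar>Im z\<bar>" using cmod_le[of z] x by simp
  show ?thesis
  proof (cases "\<bar>Im z\<bar> \<le> Re z")
    case True
    define y where "y = Re z / (c * gap S \<tau>)"
    have y: "Re z = c * gap S \<tau> * y" using g c_pos by (simp add: y_def)
    have "exp (- y) * y \<le> 1"
    proof -
      have "y \<le> exp y" using exp_ge_add_one_self[of y] by linarith
      then show ?thesis by (simp add: exp_minus divide_simps)
    qed
    have "exp (- y) * (cmod z / cmod (1 + z)) \<le> exp (- y) * (2 * Re z)"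
      using mult cz True by (intro mult_left_mono) auto
    also have "\<dots> = 2 * c * gap S \<tau> * (exp (- y) * y)"
      by (simp add: y)
    also have "\<dots> \<le> 2 * c * gap S \<tau> * 1"
      using g c_pos \<open>exp (- y) * y \<le> 1\<close> by (intro mult_left_mono) auto
    also have "\<dots> \<le> 2 * c * \<tau>" using g c_pos by simp
    also have "\<dots> \<le> (2 * c + 2 * exp (B / c)) * \<tau>" using \<tau> by simp
    finally show ?thesis by (simp add: y_def)
  next
    case False
    define s where "s = min 1 \<bar>Im z\<bar>"
    have s: "0 < s" "s \<le> 1" "s \<le> \<bar>Im z\<bar>" using False x by (auto simp: s_def)
    have "cmod z / cmod (1 + z) \<le> 2 * s"
      using mult cz False by (auto simp: s_def min_def)
    moreover have "exp (- Re z / (c * gap S \<tau>)) \<le> \<tau> / s * exp (B / c)"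
    proof -
      have "ln (s / \<tau>) - B / c \<le> gap S s / gap S \<tau> / c"
        using ratio[OF \<tau> s(1,2)] c_pos by (simp add: field_simps)
      also have "\<dots> \<le> Re z / gap S \<tau> / c"
        using gap_le_Re[OF z x s(3)] g c_pos by (intro divide_right_mono) auto
      finally have "- Re z / (c * gap S \<tau>) \<le> ln (\<tau> / s) + B / c"
        using s \<tau> by (simp add: ln_div mult.commute)
      then have "exp (- Re z / (c * gap S \<tau>)) \<le> exp (ln (\<tau> / s) + B / c)" by simp
      then show ?thesis using s \<tau> by (simp add: exp_add)
    qed
    ultimately have "exp (- Re z / (c * gap S \<tau>)) * (cmod z / cmod (1 + z))
        \<le> \<tau> / s * exp (B / c) * (2 * s)"
      using s \<tau> by (intro mult_mono) auto
    also have "\<dots> = 2 * exp (B / c) * \<tau>" using s by simp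
    also have "\<dots> \<le> (2 * c + 2 * exp (B / c)) * \<tau>" using \<tau> c_pos by simp
    finally show ?thesis .
  qed
qed

text \<open>The three summands of the constant come from the estimate \<open>c ln x \<le> x / 4 + \<bar>c ln (4 c)\<bar>\<close>, from the
  constant \<open>C\<close> (a point with \<open>\<bar>z\<bar> \<ge> s / 2\<close> has multiplier at least \<open>s / 3\<close>), and from the tolerance \<open>gap S \<tau>\<close> with which \<open>gap S s\<close> is realised.\<close>

lemma gap_ratio_ge:
  assumes C: "0 < C"
    and mult: "\<And>z \<tau>. z \<in> S \<Longrightarrow> 0 < \<tau> \<Longrightarrow> \<tau> \<le> 1 \<Longrightarrow>
      exp (- Re z / (c * gap S \<tau>)) * (cmod z / cmod (1 + z)) \<le> C * \<tau>"
    and \<tau>: "0 < \<tau>" "\<tau> \<le> 1" and s: "0 < s" "s \<le> 1"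
  shows "c * ln (s / \<tau>) - (\<bar>c * ln (4 * c)\<bar> + \<bar>c * ln (3 * C)\<bar> + 1) \<le> gap S s / gap S \<tau>"
proof -
  have g: "0 < gap S \<tau>" "gap S \<tau> \<le> \<tau>" "0 < gap S s"
    using gap_pos gap_le_self zero_mem \<tau> s by auto
  consider "s \<le> \<tau>" | "s / 4 \<le> gap S s" | "\<tau> < s" "gap S s < s / 4" by linarith
  then show ?thesis
  proof cases
    case 1
    then have "c * ln (s / \<tau>) \<le> 0" using \<tau> s c_pos by (simp add: mult_le_0_iff)
    moreover have "0 \<le> gap S s / gap S \<tau>" using g by simp
    ultimately show ?thesis by linarith
  next
    case 2
    define x where "x = s / \<tau>"
    have x: "0 < x" using s \<tau> by (simp add: x_def)
    have "ln (x / (4 * c)) \<le> x / (4 * c) - 1" using x c_pos by (intro ln_le_minus_one) auto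
    then have "ln x \<le> x / (4 * c) + ln (4 * c)" using x c_pos by (simp add: ln_div)
    then have "c * ln x \<le> c * (x / (4 * c) + ln (4 * c))"
      using c_pos by (intro mult_left_mono) auto
    also have "\<dots> = x / 4 + c * ln (4 * c)" using c_pos by (simp add: field_simps)
    also have "x / 4 \<le> gap S s / gap S \<tau>"
      using frac_le[of "gap S s" "s / 4" "gap S \<tau>" \<tau>] 2 g s by (simp add: x_def mult.commute)
    finally show ?thesis unfolding x_def by linarith
  next
    case 3
    have "S \<noteq> {}" using zero_mem by auto
    then obtain z r where z: "z \<in> S" and r: "s \<le> \<bar>r\<bar>"
      and zr: "cmod (z + \<i> * of_real r) < gap S s + gap S \<tau>"
      using gap_almost_attained[of S s "gap S s + gap S \<tau>"] g by auto
    have "gap S \<tau> \<le> gap S s" using gap_mono[OF \<open>S \<noteq> {}\<close>, of \<tau> s] 3 by simp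
    have "\<bar>r\<bar> = cmod ((z + \<i> * of_real r) - z)" by (simp add: norm_mult)
    also have "\<dots> \<le> cmod (z + \<i> * of_real r) + cmod z" by (rule norm_triangle_ineq4)
    finally have z_ge: "s / 2 \<le> cmod z"
      using r zr 3 \<open>gap S \<tau> \<le> gap S s\<close> by linarith
    have Re_le: "Re z \<le> gap S s + gap S \<tau>"
      using complex_Re_le_cmod[of "z + \<i> * of_real r"] zr by simp
    have "s / 3 \<le> cmod z / (1 + cmod z)"
    proof -
      have "s / 3 \<le> (s / 2) / (1 + s / 2)" using s by (simp add: field_simps)
      also have "\<dots> \<le> cmod z / (1 + cmod z)" using s z_ge by (simp add: field_simps)
      finally show ?thesis .
    qed
    also have "\<dots> \<le> cmod z / cmod (1 + z)"
    proof (rule divide_left_mono)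
      show "cmod (1 + z) \<le> 1 + cmod z" using norm_triangle_ineq[of 1 z] by simp
      have "1 \<le> cmod (1 + z)" using complex_Re_le_cmod[of "1 + z"] Re_nonneg[OF z] by simp
      then show "0 < (1 + cmod z) * cmod (1 + z)" by (intro mult_pos_pos) (auto intro: add_pos_nonneg)
    qed simp
    finally have "exp (- Re z / (c * gap S \<tau>)) * (s / 3) \<le> C * \<tau>"
      using mult[OF z \<tau>] by (smt (verit) exp_gt_zero mult_left_mono)
    then have "s / \<tau> \<le> 3 * C * exp (Re z / (c * gap S \<tau>))"
      using \<tau> by (simp add: exp_minus field_simps)
    then have "ln (s / \<tau>) \<le> ln (3 * C * exp (Re z / (c * gap S \<tau>)))"
      using s \<tau> C by simp
    also have "\<dots> = ln (3 * C) + Re z / (c * gap S \<tau>)"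
      using C by (subst ln_mult) auto
    finally have "c * ln (s / \<tau>) \<le> c * (ln (3 * C) + Re z / (c * gap S \<tau>))"
      using c_pos by (intro mult_left_mono) auto
    also have "\<dots> = c * ln (3 * C) + Re z / gap S \<tau>" using c_pos by (simp add: field_simps)
    also have "Re z / gap S \<tau> \<le> gap S s / gap S \<tau> + 1"
      using Re_le g by (simp add: field_simps)
    finally show ?thesis by linarith
  qed
qed

end

section \<open>Rational functions of degree one\<close>

lemma scaleC_one [simp]: "1 *\<^sub>C x = (x :: 'a::complex_normed_vector)"
  using scaleC_of_real[of 1 x] by simp

lemma scaleC_zero_left [simp]: "0 *\<^sub>C x = (0 :: 'a::complex_normed_vector)"
  using scaleC_of_real[of 0 x] by simp

lemma inv_poly_op_linear:
  "inv_into (pow_domain D A (degree [:w, 1:])) (poly_op A [:w, 1:]) = plus_inv D A w"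
proof -
  have "poly_op A [:w, 1:] = (\<lambda>x. w *\<^sub>C x + A x)"
    by (simp add: poly_op_def fun_eq_iff)
  moreover have "pow_domain D A (degree [:w, 1:]) = D"
    by (auto simp: pow_domain_def)
  ultimately show ?thesis by (simp add: plus_inv_def)
qed

lemma rat_op_resolvent: "rat_op D A 1 [:w, 1:] = plus_inv D A w"
  unfolding rat_op_def inv_poly_op_linear by (simp add: poly_op_def fun_eq_iff)

lemma rat_op_multiplier: "rat_op D A [:0, 1:] [:1, 1:] = (\<lambda>x. A (plus_inv D A 1 x))"
  unfolding rat_op_def inv_poly_op_linear by (simp add: poly_op_def fun_eq_iff)

lemma quasi_multiplication_onorm:
  assumes "quasi_multiplication_semigroup T D A" "0 \<le> t"
    and "q \<noteq> 0" "coprime p q" "degree p \<le> degree q" "\<And>z. z \<in> spectrum D A \<Longrightarrow> poly q z \<noteq> 0"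
  shows "ennreal (onorm (\<lambda>x. T t (rat_op D A p q x))) =
    (SUP z\<in>spectrum D A. ennreal (exp (- Re z * t) * (cmod (poly p z) / cmod (poly q z))))"
  using assms unfolding quasi_multiplication_semigroup_def
  by (simp add: norm_mult norm_divide)

lemma onorm_plus_inv:
  assumes qm: "quasi_multiplication_semigroup T D A" and "- w \<notin> spectrum D A"
  shows "ennreal (onorm (plus_inv D A w)) = (SUP z\<in>spectrum D A. ennreal (1 / cmod (z + w)))"
proof -
  have "T 0 x = x" for x
    using qm by (simp add: quasi_multiplication_semigroup_def C0_semigroup_def)
  moreover have "poly [:w, 1:] z \<noteq> 0" if "z \<in> spectrum D A" for z
    using that assms(2) by (auto simp: add_eq_0_iff)
  ultimately show ?thesis
    using quasi_multiplication_onorm[OF qm, of 0 "[:w, 1:]" 1]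
    by (simp add: rat_op_resolvent add.commute)
qed

lemma onorm_multiplier:
  assumes qm: "quasi_multiplication_semigroup T D A" and "- 1 \<notin> spectrum D A" "0 \<le> t"
  shows "ennreal (onorm (\<lambda>x. T t (A (plus_inv D A 1 x)))) =
    (SUP z\<in>spectrum D A. ennreal (exp (- Re z * t) * (cmod z / cmod (1 + z))))"
proof -
  have "coprime [:0, 1:] [:1, 1 :: complex:]"
  proof (rule coprimeI)
    fix d :: "complex poly" assume "d dvd [:0, 1:]" "d dvd [:1, 1:]"
    then have "d dvd [:1, 1:] - [:0, 1:]" by (rule dvd_diff[rotated])
    then show "is_unit d" by (simp add: one_pCons)
  qed
  moreover have "poly [:1, 1:] z \<noteq> 0" if "z \<in> spectrum D A" for z
    using that assms(2) by (auto simp: add_eq_0_iff add.commute)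
  ultimately show ?thesis
    using quasi_multiplication_onorm[OF qm assms(3), of "[:1, 1:]" "[:0, 1:]"]
    by (simp add: rat_op_multiplier)
qed

section \<open>The resolvent along the imaginary axis\<close>

lemma ennreal_eq_SUP_inverse_dist:
  assumes S: "S \<noteq> {}" "- w \<notin> S" and N: "ennreal N = (SUP z\<in>S. ennreal (1 / cmod (z + w)))"
  shows "0 < infdist (- w) S" "N = 1 / infdist (- w) S"
proof -
  have pos: "0 < cmod (z + w)" if "z \<in> S" for z
    using that S(2) by (auto simp: add_eq_0_iff2)
  have le: "ennreal (1 / cmod (z + w)) \<le> ennreal N" if "z \<in> S" for z
    unfolding N using that by (rule SUP_upper)
  obtain a where a: "a \<in> S" using S(1) by blast
  have "0 < ennreal (1 / cmod (a + w))" using pos[OF a] by simp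
  then have "0 < ennreal N" using le[OF a] by (rule less_le_trans)
  then have Npos: "0 < N" by simp
  have dist_ge: "1 / N \<le> cmod (z + w)" if "z \<in> S" for z
    using le[OF that] Npos pos[OF that] by (simp add: field_simps)
  have infdist: "infdist (- w) S = (INF z\<in>S. dist (- w) z)"
    using S(1) by (rule infdist_notempty)
  have "1 / N \<le> infdist (- w) S"
    unfolding infdist using S(1) dist_ge
    by (intro cINF_greatest) (auto simp: dist_norm norm_minus_commute[of "- w"])
  moreover have "0 < 1 / N" using Npos by simp
  ultimately show infdist_pos: "0 < infdist (- w) S" by linarith
  have "ennreal N \<le> ennreal (1 / infdist (- w) S)"
    unfolding N
  proof (rule SUP_least)
    fix z assume z: "z \<in> S"
    have "infdist (- w) S \<le> cmod (z + w)"
      using infdist_le[OF z, of "- w"] by (simp add: dist_norm norm_minus_commute[of "- w"])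
    then show "ennreal (1 / cmod (z + w)) \<le> ennreal (1 / infdist (- w) S)"
      using infdist_pos pos[OF z] by (intro ennreal_leI divide_left_mono) auto
  qed
  then have "N \<le> 1 / infdist (- w) S"
    using infdist_pos by (simp add: ennreal_le_iff)
  then show "N = 1 / infdist (- w) S"
    using \<open>1 / N \<le> infdist (- w) S\<close> Npos infdist_pos by (simp add: field_simps)
qed

text \<open>The real supremum is meaningful only if \<open>N\<close> is bounded on \<open>\<bar>r\<bar> \<ge> s\<close>: far out it is the growth
  condition, and on the remaining compact set it follows from the continuity of the distance to \<open>S\<close>.\<close>

lemma SUP_resolvent_eq_inverse_gap:
  fixes N :: "real \<Rightarrow> real"
  assumes S: "S \<noteq> {}" and off: "\<And>r. r \<noteq> 0 \<Longrightarrow> - (\<i> * of_real r) \<notin> S"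
    and N: "\<And>r. r \<noteq> 0 \<Longrightarrow> ennreal (N r) = (SUP z\<in>S. ennreal (1 / cmod (z + \<i> * of_real r)))"
    and growth: "N \<in> O[at_infinity](\<lambda>_. 1)"
    and s: "0 < s"
  shows "0 < gap S s" "(SUP r\<in>{r. s \<le> \<bar>r\<bar>}. N r) = 1 / gap S s"
proof -
  define I where "I = {r. s \<le> \<bar>r\<bar>}"
  define d where "d r = infdist (- (\<i> * complex_of_real r)) S" for r
  have d: "0 < d r" "N r = 1 / d r" if "r \<in> I" for r
    using ennreal_eq_SUP_inverse_dist[OF S off N, of r] that s by (auto simp: d_def I_def)
  obtain K b where K: "\<And>r. b \<le> \<bar>r\<bar> \<Longrightarrow> \<bar>N r\<bar> \<le> K"
    using growth by (auto simp: bigo_def eventually_at_infinity)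
  have "bdd_above (N ` I)"
  proof -
    define J where "J = I \<inter> {-b..b}"
    have "compact J"
    proof -
      have "I = {r. s \<le> r} \<union> {r. r \<le> - s}" by (auto simp: I_def)
      then have "closed I" by (simp add: closed_Un closed_Collect_le)
      then show ?thesis unfolding J_def by (intro closed_Int_compact) auto
    qed
    moreover have "continuous_on J (\<lambda>r. 1 / d r)"
      using d(1) unfolding d_def J_def by (intro continuous_intros) fastforce
    ultimately have "bdd_above ((\<lambda>r. 1 / d r) ` J)"
      by (intro bounded_imp_bdd_above compact_imp_bounded compact_continuous_image)
    then obtain L where L: "1 / d r \<le> L" if "r \<in> J" for r
      by (auto simp: bdd_above_def)
    have "N r \<le> max K L" if "r \<in> I" for r
    proof (cases "b \<le> \<bar>r\<bar>")
      case True
      then show ?thesis using K[of r] by linarith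
    next
      case False
      then have "r \<in> J" using that by (auto simp: J_def)
      then show ?thesis using L d(2)[OF that] by (simp add: le_max_iff_disj)
    qed
    then show ?thesis by (intro bdd_aboveI2)
  qed
  then have le_SUP: "N r \<le> (SUP r\<in>I. N r)" if "r \<in> I" for r
    using that by (rule cSUP_upper[rotated])
  have "s \<in> I" using s by (simp add: I_def)
  have SUP_pos: "0 < (SUP r\<in>I. N r)"
  proof -
    have "0 < N s" using d[OF \<open>s \<in> I\<close>] by simp
    then show ?thesis using le_SUP[OF \<open>s \<in> I\<close>] by linarith
  qed
  have "1 / (SUP r\<in>I. N r) \<le> gap S s"
  proof (rule gap_geI[OF S])
    fix z r assume z: "z \<in> S" and "s \<le> \<bar>r\<bar>"
    then have r: "r \<in> I" by (simp add: I_def)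
    have "1 / (SUP r\<in>I. N r) \<le> d r"
      using le_SUP[OF r] d[OF r] SUP_pos by (simp add: field_simps)
    also have "\<dots> \<le> cmod (z + \<i> * of_real r)"
      using infdist_le[OF z, of "- (\<i> * of_real r)"]
      by (simp add: d_def dist_norm norm_minus_commute[of "- (\<i> * of_real r)"])
    finally show "1 / (SUP r\<in>I. N r) \<le> cmod (z + \<i> * of_real r)" .
  qed
  moreover have "0 < 1 / (SUP r\<in>I. N r)" using SUP_pos by simp
  ultimately have g: "0 < gap S s" by linarith
  then show "0 < gap S s" .
  have "(SUP r\<in>I. N r) \<le> 1 / gap S s"
  proof (rule cSUP_least)
    fix r assume r: "r \<in> I"
    have "gap S s \<le> d r"
      unfolding d_def infdist_notempty[OF S]
    proof (rule cINF_greatest[OF S])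
      fix z assume "z \<in> S"
      then show "gap S s \<le> dist (- (\<i> * of_real r)) z"
        using gap_le_dist[of z S s r] r
        by (simp add: I_def dist_norm norm_minus_commute[of "- (\<i> * of_real r)"])
    qed
    then show "N r \<le> 1 / gap S s"
      using d[OF r] g by (simp add: frac_le)
  qed (use \<open>s \<in> I\<close> in auto)
  with \<open>1 / (SUP r\<in>I. N r) \<le> gap S s\<close> show "(SUP r\<in>{r. s \<le> \<bar>r\<bar>}. N r) = 1 / gap S s"
    unfolding I_def[symmetric] using g SUP_pos by (simp add: field_simps)
qed

section \<open>The equivalence\<close>

theorem proposition6p13:
  fixes T :: "real \<Rightarrow> 'a::complex_banach \<Rightarrow> 'a"
    and D :: "'a set" and A :: "'a \<Rightarrow> 'a"
    and c :: real and m minv :: "real \<Rightarrow> real"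
  assumes "quasi_multiplication_semigroup T D A"
    and "0 \<in> spectrum D A"
    and "spectrum D A \<subseteq> {z. Re z > 0} \<union> {0}"
    and "(\<lambda>s::real. onorm (plus_inv D A (\<i> * of_real s))) \<in> O[at_infinity](\<lambda>_. 1)"
    and "c > 0"
    and "\<And>s. s > 0 \<Longrightarrow> m s = (SUP r\<in>{r::real. \<bar>r\<bar> \<ge> s}. onorm (plus_inv D A (\<i> * of_real r)))"
    and "\<And>t. t \<in> m ` {0<..} \<Longrightarrow> minv t > 0 \<and> m (minv t) = t"
  shows "(\<exists>C. \<forall>t\<ge>m 1 / c. onorm (\<lambda>x. T t (A (plus_inv D A 1 x))) \<le> C * minv (c * t))
     \<longleftrightarrow> (\<exists>B. \<forall>\<tau> s. 0 < \<tau> \<and> \<tau> \<le> 1 \<and> 0 < s \<and> s \<le> 1 \<longrightarrow> m \<tau> / m s \<ge> c * ln (s / \<tau>) - B)"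
    (is "?decay \<longleftrightarrow> ?ratio")
proof -
  define S where "S = spectrum D A"
  have S0: "0 \<in> S" and ne: "S \<noteq> {}" using assms(2) by (auto simp: S_def)
  have S: "0 \<le> Re z" "Re z = 0 \<Longrightarrow> z = 0" if "z \<in> S" for z
    using assms(3) that by (auto simp: S_def)
  have off: "- (\<i> * of_real r) \<notin> S" if "r \<noteq> 0" for r
    using S(2)[of "- (\<i> * of_real r)"] that by auto
  have "- 1 \<notin> S" using S(1)[of "- 1"] by auto
  have gap: "0 < gap S s" "m s = 1 / gap S s" if "0 < s" for s
    using SUP_resolvent_eq_inverse_gap[OF ne off onorm_plus_inv[OF assms(1), folded S_def]
        assms(4) that] off assms(6)[OF that] by auto
  interpret spectral_region S c
    using S0 S(1) gap(1) assms(5) by unfold_locales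
  define W where "W t = onorm (\<lambda>x. T t (A (plus_inv D A 1 x)))" for t
  define val where "val t z = exp (- Re z * t) * (cmod z / cmod (1 + z))" for t z
  have W: "ennreal (W t) = (SUP z\<in>S. ennreal (val t z))" if "0 \<le> t" for t
    using onorm_multiplier[OF assms(1) _ that] \<open>- 1 \<notin> S\<close> by (simp add: W_def val_def S_def)
  have antimono: "m s' \<le> m s" if "0 < s" "s \<le> s'" for s s'
    using gap[of s] gap[of s'] gap_mono[OF ne that(2)] that by (simp add: frac_le)
  have m1: "0 < m 1" using gap[of 1] by simp
  have minv: "0 < minv u" "m (minv u) = u" if "m 1 \<le> u" for u
  proof -
    have "0 < u" using that m1 by linarith
    then have "0 < 1 / u" "1 / u \<le> gap S 1"
      using that gap[of 1] by (auto simp: field_simps)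
    then obtain \<tau> where "0 < \<tau>" "gap S \<tau> = 1 / u" using gap_surj[OF S0] by blast
    then have "u = m \<tau>" using gap(2) by simp
    then have "u \<in> m ` {0<..}" using \<open>0 < \<tau>\<close> by blast
    then show "0 < minv u" "m (minv u) = u" using assms(7) by auto
  qed
  have val_gap: "val (m \<tau> / c) z = exp (- Re z / (c * gap S \<tau>)) * (cmod z / cmod (1 + z))"
    if "0 < \<tau>" for \<tau> z
    using gap(2)[OF that] by (simp add: val_def mult.commute)
  show ?thesis
  proof
    assume ?decay
    then obtain C where C: "\<And>t. m 1 / c \<le> t \<Longrightarrow> W t \<le> C * minv (c * t)"
      by (auto simp: W_def)
    define K where "K = max 1 C"
    have "0 < K" by (simp add: K_def)
    then have "0 < exp 1 * K" by simp
    have bound: "val (m \<tau> / c) z \<le> exp 1 * K * \<tau>" if z: "z \<in> S" and \<tau>: "0 < \<tau>" "\<tau> \<le> 1" for z \<tau>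
    proof -
      \<comment> \<open>A delay by \<open>h\<close> puts the value of \<open>minv\<close> below \<open>\<tau>\<close> and costs at most a factor \<open>e\<close> at \<open>z\<close>.\<close>
      define h where "h = 1 / (Re z + 1)"
      have h: "0 < h" "Re z * h \<le> 1" using S(1)[OF z] by (auto simp: h_def field_simps)
      define t where "t = m \<tau> / c + h"
      have ct: "c * t = m \<tau> + c * h" using c_pos by (simp add: t_def field_simps)
      have "0 < c * h" using c_pos h by simp
      have ct_gt: "m \<tau> < c * t" "m 1 \<le> c * t"
        using antimono[OF \<tau>] ct \<open>0 < c * h\<close> by auto
      have t: "m 1 / c \<le> t" using ct_gt c_pos by (simp add: field_simps)
      have "0 \<le> t" using t m1 c_pos by (meson divide_nonneg_pos less_imp_le order_trans)
      have "minv (c * t) < \<tau>"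
        using minv[OF ct_gt(2)] antimono[of \<tau> "minv (c * t)"] ct_gt(1) \<tau> by force
      have "ennreal (val t z) \<le> ennreal (W t)" unfolding W[OF \<open>0 \<le> t\<close>] using z by (rule SUP_upper)
      also have "\<dots> \<le> ennreal (K * minv (c * t))"
      proof (rule ennreal_leI)
        have "C * minv (c * t) \<le> K * minv (c * t)"
          using minv(1)[OF ct_gt(2)] by (simp add: K_def)
        then show "W t \<le> K * minv (c * t)" using C[OF t] by linarith
      qed
      finally have "val t z \<le> K * minv (c * t)"
        using minv(1)[OF ct_gt(2)] by (subst (asm) ennreal_le_iff) (auto simp: K_def)
      also have "\<dots> \<le> K * \<tau>" using \<open>minv (c * t) < \<tau>\<close> \<open>0 < K\<close> by simp
      finally have "val t z \<le> K * \<tau>" .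
      have "val (m \<tau> / c) z = exp (Re z * h) * val t z"
        by (simp add: val_def t_def flip: exp_add) (simp add: algebra_simps)
      also have "\<dots> \<le> exp 1 * (K * \<tau>)"
        using h \<open>val t z \<le> K * \<tau>\<close> by (intro mult_mono) (auto simp: val_def)
      finally show ?thesis by (simp add: mult.assoc)
    qed
    have "c * ln (s / \<tau>) - (\<bar>c * ln (4 * c)\<bar> + \<bar>c * ln (3 * (exp 1 * K))\<bar> + 1)
        \<le> gap S s / gap S \<tau>" if "0 < \<tau>" "\<tau> \<le> 1" "0 < s" "s \<le> 1" for \<tau> s
      by (rule gap_ratio_ge[OF \<open>0 < exp 1 * K\<close> _ that]) (metis bound val_gap)
    then show ?ratio
      using gap(2) by (intro exI[of _ "\<bar>c * ln (4 * c)\<bar> + \<bar>c * ln (3 * (exp 1 * K))\<bar> + 1"]) auto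
  next
    assume ?ratio
    then obtain B where B: "c * ln (s / \<tau>) - B \<le> gap S s / gap S \<tau>"
      if "0 < \<tau>" "\<tau> \<le> 1" "0 < s" "s \<le> 1" for \<tau> s
      using gap(2) by auto
    define K where "K = 2 * c + 2 * exp (B / c)"
    have K: "0 < K" using c_pos by (simp add: K_def add_pos_pos)
    have "W t \<le> K * minv (c * t)" if t: "m 1 / c \<le> t" for t
    proof -
      have ct: "m 1 \<le> c * t" using t c_pos by (simp add: field_simps)
      have "0 \<le> t" using t m1 c_pos by (meson divide_nonneg_pos less_imp_le order_trans)
      \<comment> \<open>If \<open>minv (c * t)\<close> exceeds \<open>1\<close>, then \<open>m\<close> is constant between \<open>1\<close> and that value.\<close>
      define \<tau> where "\<tau> = min 1 (minv (c * t))"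
      have \<tau>: "0 < \<tau>" "\<tau> \<le> 1" "\<tau> \<le> minv (c * t)" using minv(1)[OF ct] by (auto simp: \<tau>_def)
      have "m \<tau> = c * t"
        using minv(2)[OF ct] antimono[of 1 "minv (c * t)"] ct by (auto simp: \<tau>_def min_def)
      then have t_eq: "t = m \<tau> / c" using c_pos by simp
      have "ennreal (W t) \<le> ennreal (K * \<tau>)"
        unfolding W[OF \<open>0 \<le> t\<close>]
      proof (intro SUP_least ennreal_leI)
        fix z assume "z \<in> S"
        then show "val t z \<le> K * \<tau>"
          unfolding t_eq val_gap[OF \<tau>(1)] K_def using B \<tau> by (intro damped_multiplier_le) auto
      qed
      then have "W t \<le> K * \<tau>" using K \<tau> by (subst (asm) ennreal_le_iff) auto
      also have "\<dots> \<le> K * minv (c * t)" using K \<tau> by simp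
      finally show ?thesis .
    qed
    then show ?decay unfolding W_def by blast
  qed
qed

end
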